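(* Let $G$ be a Cayley graph of an infinite finitely generated group (with respect to a finite generating set), and let $a>0$. (1) If $\Lambda_G(N)\simeq \frac{1}{\log(N)^a}$, then there is $K>0$ such that for infinitely many $N$, $\frac{\mathrm{Sep}_G(N)}{N}\ge K\frac{\Lambda_G(N)}{\log N}$ (where $\frac{\Lambda_G(N)}{\log N}\simeq\frac{1}{\log^{1+a}(N)}$). (2) If $\Lambda_G(N)\simeq \frac{1}{\log^a(\log N)}$, then there are $K>0$ and $C>0$ such that for infinitely many $N$, $\frac{\mathrm{Sep}_G(N)}{N}\ge K\frac{\Lambda_G(N)}{\log(N)^C}$ (where $\frac{\Lambda_G(N)}{\log(N)^C}\simeq\frac{1}{\log^a(\log N)\cdot\log(N)^C}$). (3) If $\Lambda_G(N)\preceq \frac{1}{(\log N)^a}$, then there is $K>0$ such that for infinitely many $N$, $\frac{\mathrm{Sep}_G(N)}{N}\ge K\frac{\Lambda_G(N)}{\log N}$. (4) If $\Lambda_G(N)\preceq \frac{1}{(\log^{(k)} N)^a}$ for some integer $k\ge 2$, where $\log^{(k)}$ denotes the $k$-fold iterated logarithm, then for every $\varepsilon>0$ there is $K>0$ such that for infinitely many $N$, $\frac{\mathrm{Sep}_G(N)}{N}\ge K\frac{\Lambda_G(N)}{N^{\varepsilon}}$.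
   Context: For functions $u,w$ defined and positive for large integers, $u\preceq w$ means that there is $C>0$ with $u(N)\le C w(N)$ for all large $N$, and $u\simeq w$ means $u\preceq w$ and $w\preceq u$. A graph $G$ has vertex set $VG$ and edge set $EG\subset VG\times VG$; adjacency is undirected. For $A\subset VG$, $\partial A=\{(a,b)\in EG : \text{exactly one of } a,b \text{ lies in } A\}$. The isoperimetric profile is $\Lambda_G(n)=\inf\{|\partial A|/|A| : A\subset VG,\ 1\le|A|\le n\}$. For a finite graph $H$, the Cheeger constant is $h(H)=\min\{|\partial_H A|/|A| : \emptyset\ne A\subset VH,\ |A|\le |VH|/2\}$, where $\partial_H$ is the boundary in $H$. For a finite $F\subset VG$, $h(F)$ is the Cheeger constant of the subgraph of $G$ induced on $F$, with the convention $h(F)=0$ if $|F|\le1$. The separation profile is $\mathrm{Sep}_G(n)=\sup\{|F|\, h(F) : F\subset VG,\ |F|\le n\}$. *)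

theory Defs
  imports
    Complex_Main
    "HOL-Algebra.Generated_Groups"
    "Graph_Theory.Digraph_Component"
begin

text \<open>
  A graph is a \<^typ>\<open>('v, 'e) pre_digraph\<close>. An undirected edge between distinct vertices is
  represented by both of its orientations, so that the arc set is symmetric, and each
  undirected edge of a boundary is counted twice, in isoperimetric profiles as well as in
  Cheeger constants.

  Closing the generating set under inverses makes the arc set symmetric whether or not
  \<open>S\<close> is. If \<open>S\<close> contains the identity there are loops, which lie in no boundary.
\<close>

definition cayley_graph :: "('a, 'm) monoid_scheme \<Rightarrow> 'a set \<Rightarrow> ('a, 'a \<times> 'a) pre_digraph" where
  "cayley_graph \<Gamma> S =
     \<lparr> verts = carrier \<Gamma>,
       arcs = {(g, g \<otimes>\<^bsub>\<Gamma>\<^esub> s) | g s. g \<in> carrier \<Gamma> \<and> s \<in> S \<union> (\<lambda>t. inv\<^bsub>\<Gamma>\<^esub> t) ` S},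
       tail = fst, head = snd \<rparr>"

definition edge_boundary :: "('v, 'e) pre_digraph \<Rightarrow> 'v set \<Rightarrow> 'e set" where
  "edge_boundary G A = {e \<in> arcs G. (tail G e \<in> A) \<noteq> (head G e \<in> A)}"

text \<open>The infimum is a genuine one for \<open>n \<ge> 1\<close> and a nonempty graph.\<close>

definition isoperimetric_profile :: "('v, 'e) pre_digraph \<Rightarrow> nat \<Rightarrow> real" where
  "isoperimetric_profile G n =
     Inf {real (card (edge_boundary G A)) / real (card A) | A.
            A \<subseteq> verts G \<and> finite A \<and> 1 \<le> card A \<and> card A \<le> n}"

text \<open>Meaningful for finite graphs with at least two vertices, where the set is nonempty.\<close>

definition cheeger :: "('v, 'e) pre_digraph \<Rightarrow> real" where
  "cheeger H =
     Min {real (card (edge_boundary H A)) / real (card A) | A.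
            A \<subseteq> verts H \<and> A \<noteq> {} \<and> real (card A) \<le> real (card (verts H)) / 2}"

definition cheeger_subset :: "('v, 'e) pre_digraph \<Rightarrow> 'v set \<Rightarrow> real" where
  "cheeger_subset G F = (if card F \<le> 1 then 0 else cheeger (induce_subgraph G F))"

text \<open>
  For a graph without multiple edges, such as a Cayley graph as above, \<open>F\<close> spans at most
  \<open>n\<^sup>2\<close> arcs, so the set is bounded and the real supremum is a genuine one.
\<close>

definition separation_profile :: "('v, 'e) pre_digraph \<Rightarrow> nat \<Rightarrow> real" where
  "separation_profile G n =
     Sup {real (card F) * cheeger_subset G F | F. F \<subseteq> verts G \<and> finite F \<and> card F \<le> n}"

definition asymp_le :: "(nat \<Rightarrow> real) \<Rightarrow> (nat \<Rightarrow> real) \<Rightarrow> bool" (infix "\<preceq>" 50) where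
  "u \<preceq> w \<longleftrightarrow> (\<exists>C>0. \<forall>\<^sub>F N in sequentially. u N \<le> C * w N)"

definition asymp_eq :: "(nat \<Rightarrow> real) \<Rightarrow> (nat \<Rightarrow> real) \<Rightarrow> bool" (infix "\<simeq>" 50) where
  "u \<simeq> w \<longleftrightarrow> u \<preceq> w \<and> w \<preceq> u"

end

theory Submission
  imports Defs "HOL-Analysis.Summation_Tests" "HOL-Real_Asymp.Real_Asymp"
begin

text \<open>
  If \<open>F\<close> attains \<open>\<Lambda>(N)\<close> and \<open>A \<subseteq> F\<close> has at most half of its vertices, then comparing
  \<open>\<partial>A\<close> and \<open>\<partial>(F - A)\<close> with \<open>\<partial>F\<close> gives \<open>2 |\<partial>\<^sub>F A| \<ge> (\<Lambda>(N/2) - \<Lambda>(N)) |A|\<close>, hence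
  \<open>Sep(N)/N \<ge> (\<Lambda>(N/2) - \<Lambda>(N))/4\<close>. If \<open>\<Lambda>(N/2) \<le> (1 + w(N)) \<Lambda>(N)\<close> for all large \<open>N\<close>, then
  along powers of two \<open>\<Lambda>(2^k) \<ge> c exp(- w(2) - \<dots> - w(2^k))\<close>, which for a suitable \<open>w\<close>
  contradicts the assumed decay of \<open>\<Lambda>\<close>.
\<close>

section \<open>Isoperimetry and separation in locally finite graphs\<close>

text \<open>An arc inside \<open>F\<close> that separates \<open>A\<close> from \<open>F - A\<close>
  lies in both boundaries on the left, hence the factor 2. Any other arc of these boundaries leaves
  \<open>F\<close>, so it belongs to the boundary of \<open>F\<close> and is met only once.\<close>

lemma card_edge_boundary_partition_le:
  assumes "A \<subseteq> F" and "finite (edge_boundary G A)" and "finite (edge_boundary G (F - A))"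
    and "finite (edge_boundary G F)"
  shows "card (edge_boundary G A) + card (edge_boundary G (F - A))
    \<le> card (edge_boundary G F) + 2 * card (edge_boundary (induce_subgraph G F) A)"
proof -
  let ?I = "edge_boundary (induce_subgraph G F) A"
  have "?I \<subseteq> edge_boundary G A"
    by (auto simp: edge_boundary_def)
  hence fin: "finite ?I"
    using assms(2) finite_subset by blast
  have un: "edge_boundary G A \<union> edge_boundary G (F - A) \<subseteq> edge_boundary G F \<union> ?I"
    and int: "edge_boundary G A \<inter> edge_boundary G (F - A) \<subseteq> ?I"
    using assms(1) by (auto simp: edge_boundary_def)
  have "card (edge_boundary G A) + card (edge_boundary G (F - A))
      = card (edge_boundary G A \<union> edge_boundary G (F - A))
        + card (edge_boundary G A \<inter> edge_boundary G (F - A))"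
    using assms(2,3) by (rule card_Un_Int)
  also have "\<dots> \<le> card (edge_boundary G F \<union> ?I) + card ?I"
    using un int fin assms(4) by (intro add_mono card_mono) auto
  also have "\<dots> \<le> card (edge_boundary G F) + 2 * card ?I"
    using card_Un_le[of "edge_boundary G F" ?I] by simp
  finally show ?thesis .
qed

lemma isoperimetric_profile_le:
  assumes "A \<subseteq> verts G" "finite A" "1 \<le> card A" "card A \<le> n"
  shows "isoperimetric_profile G n \<le> real (card (edge_boundary G A)) / real (card A)"
  unfolding isoperimetric_profile_def
  by (rule cInf_lower) (use assms in \<open>auto intro!: bdd_belowI[of _ 0]\<close>)

text \<open>Only finitely many denominators occur, so the infimum is a minimum.\<close>

lemma isoperimetric_profile_attained:
  assumes "verts G \<noteq> {}" "1 \<le> n"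
  obtains A where "A \<subseteq> verts G" "finite A" "1 \<le> card A" "card A \<le> n"
    "isoperimetric_profile G n = real (card (edge_boundary G A)) / real (card A)"
proof -
  define P where "P A \<longleftrightarrow> A \<subseteq> verts G \<and> finite A \<and> 1 \<le> card A \<and> card A \<le> n" for A
  \<comment> \<open>Since \<open>card A\<close> divides \<open>fact n\<close>, the division is exact
    and \<open>m A\<close> is the boundary ratio scaled by \<open>fact n\<close>. Ratios thus become
    natural numbers, among which a least one exists.\<close>
  define m where "m A = card (edge_boundary G A) * (fact n div card A)" for A :: "'a set"
  obtain v where "v \<in> verts G"
    using assms(1) by blast
  hence "P {v}"
    using assms(2) by (simp add: P_def)
  then obtain A where A: "P A" "\<And>B. P B \<Longrightarrow> m A \<le> m B"
    using ex_has_least_nat[of P "{v}" m] by blast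
  have m: "real (card (edge_boundary G B)) / real (card B) = real (m B) / fact n" if "P B" for B
  proof -
    have "card B dvd fact n"
      using that by (intro dvd_fact) (auto simp: P_def)
    hence "real (fact n div card B) = fact n / real (card B)"
      by (simp add: real_of_nat_div)
    thus ?thesis
      by (simp add: m_def)
  qed
  have "isoperimetric_profile G n = real (card (edge_boundary G A)) / real (card A)"
    unfolding isoperimetric_profile_def
  proof (rule cInf_eq_minimum)
    show "real (card (edge_boundary G A)) / real (card A)
      \<in> {real (card (edge_boundary G A)) / real (card A) | A.
            A \<subseteq> verts G \<and> finite A \<and> 1 \<le> card A \<and> card A \<le> n}"
      using A(1) unfolding P_def by blast
  next
    fix x
    assume "x \<in> {real (card (edge_boundary G A)) / real (card A) | A.
            A \<subseteq> verts G \<and> finite A \<and> 1 \<le> card A \<and> card A \<le> n}"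
    then obtain B where B: "P B" "x = real (card (edge_boundary G B)) / real (card B)"
      unfolding P_def by blast
    show "real (card (edge_boundary G A)) / real (card A) \<le> x"
      using A(2)[OF B(1)] by (simp add: B(2) m[OF A(1)] m[OF B(1)] divide_right_mono)
  qed
  thus ?thesis
    using that A(1) unfolding P_def by blast
qed

text \<open>The image form shows that the minimum runs over a finite set when \<open>F\<close> is
  finite, and the halving condition moves to the naturals.\<close>

lemma cheeger_subset_eq_Min:
  assumes "2 \<le> card F"
  shows "cheeger_subset G F =
    Min ((\<lambda>A. real (card (edge_boundary (induce_subgraph G F) A)) / real (card A)) `
      {A. A \<subseteq> F \<and> A \<noteq> {} \<and> 2 * card A \<le> card F})"
proof -
  have half: "real m \<le> real n / 2 \<longleftrightarrow> 2 * m \<le> n" for m n :: nat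
    by linarith
  show ?thesis
    unfolding cheeger_subset_def cheeger_def setcompr_eq_image half using assms by simp
qed

lemma cheeger_subset_ge:
  assumes "finite F" "2 \<le> card F"
    and "\<And>A. A \<subseteq> F \<Longrightarrow> A \<noteq> {} \<Longrightarrow> 2 * card A \<le> card F \<Longrightarrow>
      x \<le> real (card (edge_boundary (induce_subgraph G F) A)) / real (card A)"
  shows "x \<le> cheeger_subset G F"
  unfolding cheeger_subset_eq_Min[OF assms(2)]
proof (rule Min.boundedI)
  \<comment> \<open>A singleton is an admissible competitor because \<open>F\<close> has at least
    two elements, so \<open>Min\<close> is not taken over the empty set.\<close>
  obtain v where "v \<in> F"
    using assms(2) by fastforce
  hence "{v} \<in> {A. A \<subseteq> F \<and> A \<noteq> {} \<and> 2 * card A \<le> card F}"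
    using assms(2) by simp
  thus "(\<lambda>A. real (card (edge_boundary (induce_subgraph G F) A)) / real (card A)) `
      {A. A \<subseteq> F \<and> A \<noteq> {} \<and> 2 * card A \<le> card F} \<noteq> {}"
    by blast
qed (use assms(1,3) in auto)

lemma cheeger_subset_le:
  assumes "finite F" "2 \<le> card F" "A \<subseteq> F" "A \<noteq> {}" "2 * card A \<le> card F"
  shows "cheeger_subset G F
    \<le> real (card (edge_boundary (induce_subgraph G F) A)) / real (card A)"
  unfolding cheeger_subset_eq_Min[OF assms(2)]
proof (rule Min_le)
  show "real (card (edge_boundary (induce_subgraph G F) A)) / real (card A)
    \<in> (\<lambda>A. real (card (edge_boundary (induce_subgraph G F) A)) / real (card A)) `
      {A. A \<subseteq> F \<and> A \<noteq> {} \<and> 2 * card A \<le> card F}"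
    using assms by (intro imageI) simp
qed (use assms(1) in simp)

text \<open>Without multiple arcs, an arc is determined by its pair of ends, which gives an
  injection into \<open>F \<times> F\<close>.\<close>

lemma (in nomulti_digraph) card_arcs_induce_subgraph_le:
  assumes "finite F"
  shows "finite (arcs (induce_subgraph G F))" "card (arcs (induce_subgraph G F)) \<le> card F * card F"
proof -
  let ?I = "arcs (induce_subgraph G F)"
  have inj: "inj_on (arc_to_ends G) ?I"
    using no_multi_arcs by (auto simp: inj_on_def)
  have sub: "arc_to_ends G ` ?I \<subseteq> F \<times> F"
    by (auto simp: arc_to_ends_def)
  show "finite ?I"
    using inj_on_finite[OF inj sub] assms by simp
  show "card ?I \<le> card F * card F"
    using card_inj_on_le[OF inj sub] assms by (simp add: card_cartesian_product)
qed

text \<open>A real \<open>Sup\<close> dominates its members only if the set is bounded above. The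
  crude bound \<open>n * (n * n)\<close> comes from testing the Cheeger constant on a single
  vertex.\<close>

lemma (in nomulti_digraph) separation_profile_ge:
  assumes "F \<subseteq> verts G" "finite F" "card F \<le> n"
  shows "real (card F) * cheeger_subset G F \<le> separation_profile G n"
  unfolding separation_profile_def
proof (rule cSup_upper)
  show "real (card F) * cheeger_subset G F
    \<in> {real (card F) * cheeger_subset G F | F. F \<subseteq> verts G \<and> finite F \<and> card F \<le> n}"
    using assms by blast
  have "real (card F) * cheeger_subset G F \<le> real n * real (n * n)"
    if "finite F" "card F \<le> n" for F
  proof (cases "2 \<le> card F")
    case True
    then obtain v where v: "v \<in> F"
      by fastforce
    let ?I = "induce_subgraph G F"
    have "cheeger_subset G F \<le> real (card (edge_boundary ?I {v}))"
      using cheeger_subset_le[OF that(1) True, of "{v}" G] v True by simp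
    also have "card (edge_boundary ?I {v}) \<le> card (arcs ?I)"
      using card_arcs_induce_subgraph_le(1)[OF that(1)]
      by (intro card_mono) (auto simp: edge_boundary_def)
    also have "card (arcs ?I) \<le> card F * card F"
      by (rule card_arcs_induce_subgraph_le(2)[OF that(1)])
    also have "\<dots> \<le> n * n"
      using that(2) by (intro mult_mono) auto
    finally have "cheeger_subset G F \<le> real (n * n)"
      by simp
    hence "real (card F) * cheeger_subset G F \<le> real (card F) * real (n * n)"
      by (rule mult_left_mono) simp
    also have "\<dots> \<le> real n * real (n * n)"
      using that(2) by (intro mult_right_mono) auto
    finally show ?thesis .
  qed (simp add: cheeger_subset_def)
  thus "bdd_above {real (card F) * cheeger_subset G F | F. F \<subseteq> verts G \<and> finite F \<and> card F \<le> n}"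
    by (intro bdd_aboveI[of _ "real n * real (n * n)"]) blast
qed

lemma (in nomulti_digraph) separation_profile_ge_isoperimetric_drop:
  assumes fin: "\<And>A. finite A \<Longrightarrow> A \<subseteq> verts G \<Longrightarrow> finite (edge_boundary G A)"
    and ne: "verts G \<noteq> {}" and N: "2 \<le> N"
    and drop: "isoperimetric_profile G N < isoperimetric_profile G (N div 2)"
  shows "(isoperimetric_profile G (N div 2) - isoperimetric_profile G N) / 4
    \<le> separation_profile G N / real N"
proof -
  let ?L = "isoperimetric_profile G"
  define d where "d = ?L (N div 2) - ?L N"
  obtain F where F: "F \<subseteq> verts G" "finite F" "1 \<le> card F" "card F \<le> N"
    "?L N = real (card (edge_boundary G F)) / real (card F)"
    using isoperimetric_profile_attained[OF ne, of N] N by auto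
  \<comment> \<open>Otherwise \<open>F\<close> would compete at scale \<open>N div 2\<close>, and
    the profile could not drop between the two scales.\<close>
  have "\<not> card F \<le> N div 2"
    using isoperimetric_profile_le[OF F(1-3), of "N div 2"] F(5) drop by auto
  hence large: "N \<le> 2 * card F" "2 \<le> card F"
    using N by linarith+
  have "d / 2 \<le> cheeger_subset G F"
  proof (rule cheeger_subset_ge[OF F(2) large(2)])
    fix A assume A: "A \<subseteq> F" "A \<noteq> {}" "2 * card A \<le> card F"
    let ?B = "F - A"
    have finA: "finite A"
      using A(1) F(2) finite_subset by blast
    have "card A > 0"
      using A(2) finA by (simp add: card_gt_0_iff)
    have cB: "card ?B = card F - card A"
      using finA A(1) by (rule card_Diff_subset)
    \<comment> \<open>\<open>A\<close> has at most half of at most \<open>N\<close> vertices, so it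
      competes at the smaller scale. Its complement in \<open>F\<close> is only known to compete at
      scale \<open>N\<close>.\<close>
    have "?L (N div 2) \<le> real (card (edge_boundary G A)) / real (card A)"
      using A F \<open>card A > 0\<close> finA by (intro isoperimetric_profile_le) auto
    hence 1: "?L (N div 2) * real (card A) \<le> real (card (edge_boundary G A))"
      using \<open>card A > 0\<close> by (simp add: field_simps)
    have "?L N \<le> real (card (edge_boundary G ?B)) / real (card ?B)"
      using A F cB \<open>card A > 0\<close> by (intro isoperimetric_profile_le) auto
    hence 2: "?L N * (real (card F) - real (card A)) \<le> real (card (edge_boundary G ?B))"
      using A(3) \<open>card A > 0\<close> by (simp add: cB field_simps of_nat_diff)
    have 3: "real (card (edge_boundary G F)) = ?L N * real (card F)"
      using F(3,5) by simp
    have "card (edge_boundary G A) + card (edge_boundary G ?B)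
      \<le> card (edge_boundary G F) + 2 * card (edge_boundary (induce_subgraph G F) A)"
      using A F finA by (intro card_edge_boundary_partition_le fin) auto
    hence "real (card (edge_boundary G A)) + real (card (edge_boundary G ?B))
      \<le> real (card (edge_boundary G F)) + 2 * real (card (edge_boundary (induce_subgraph G F) A))"
      by linarith
    \<comment> \<open>The terms \<open>?L N * real (card F)\<close> cancel, leaving the difference
      of the two profile values times \<open>card A\<close>.\<close>
    with 1 2 3 have "d * real (card A) \<le> 2 * real (card (edge_boundary (induce_subgraph G F) A))"
      by (simp add: d_def algebra_simps)
    thus "d / 2 \<le> real (card (edge_boundary (induce_subgraph G F) A)) / real (card A)"
      using \<open>card A > 0\<close> by (simp add: field_simps)
  qed
  moreover have "d > 0"
    using drop by (simp add: d_def)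
  \<comment> \<open>One factor 1/2 is from \<open>card F\<close> being at least
    \<open>N / 2\<close>, the other from the double count of inner arcs; together they give the
    4.\<close>
  ultimately have "(real N / 2) * (d / 2) \<le> real (card F) * cheeger_subset G F"
    using large by (intro mult_mono) auto
  also have "\<dots> \<le> separation_profile G N"
    using F by (intro separation_profile_ge) auto
  finally show ?thesis
    using N by (simp add: d_def field_simps)
qed

section \<open>Cayley graphs\<close>

context group
begin

lemma nomulti_cayley_graph:
  assumes "S \<subseteq> carrier G"
  shows "nomulti_digraph (cayley_graph G S)"
  using assms by unfold_locales (auto simp: cayley_graph_def arc_to_ends_def)

text \<open>A boundary arc is determined by a generator or its inverse, together with whichever end
  lies in \<open>A\<close>. Finiteness matters because \<open>card\<close> of an infinite set is
  0.\<close>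

lemma finite_edge_boundary_cayley_graph:
  assumes "finite S" "S \<subseteq> carrier G" "finite A"
  shows "finite (edge_boundary (cayley_graph G S) A)"
proof -
  let ?T = "S \<union> (\<lambda>t. inv t) ` S"
  have T: "?T \<subseteq> carrier G"
    using assms(2) by auto
  have "edge_boundary (cayley_graph G S) A
    \<subseteq> (\<lambda>(g, s). (g, g \<otimes> s)) ` (A \<times> ?T) \<union> (\<lambda>(h, s). (h \<otimes> inv s, h)) ` (A \<times> ?T)"
  proof
    fix e assume "e \<in> edge_boundary (cayley_graph G S) A"
    hence arc: "e \<in> {(g, g \<otimes> s) | g s. g \<in> carrier G \<and> s \<in> ?T}"
      and bd: "(fst e \<in> A) \<noteq> (snd e \<in> A)"
      by (simp_all add: edge_boundary_def cayley_graph_def)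
    from arc obtain g s where e: "e = (g, g \<otimes> s)" "g \<in> carrier G" "s \<in> ?T"
      by blast
    have "e = (\<lambda>(h, s). (h \<otimes> inv s, h)) (g \<otimes> s, s)"
      using e subsetD[OF T e(3)] by (simp add: m_assoc)
    moreover have "e = (\<lambda>(g, s). (g, g \<otimes> s)) (g, s)"
      using e by simp
    moreover have "g \<in> A \<or> g \<otimes> s \<in> A"
      using bd e(1) by auto
    ultimately show "e \<in> (\<lambda>(g, s). (g, g \<otimes> s)) ` (A \<times> ?T) \<union> (\<lambda>(h, s). (h \<otimes> inv s, h)) ` (A \<times> ?T)"
      using e(3) by blast
  qed
  thus ?thesis
    by (rule finite_subset) (use assms in auto)
qed

text \<open>A set without boundary is closed under right multiplication by generators and their
  inverses, hence by the whole group. Being nonempty it is then the whole carrier, which is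
  infinite.\<close>

lemma edge_boundary_cayley_graph_nonempty:
  assumes "infinite (carrier G)" "S \<subseteq> carrier G" "generate G S = carrier G"
    and A: "A \<subseteq> carrier G" "finite A" "A \<noteq> {}"
  shows "edge_boundary (cayley_graph G S) A \<noteq> {}"
proof
  assume empty: "edge_boundary (cayley_graph G S) A = {}"
  have step: "a \<otimes> s \<in> A" if "a \<in> A" "s \<in> S \<union> (\<lambda>t. inv t) ` S" for a s
  proof (rule ccontr)
    assume "a \<otimes> s \<notin> A"
    hence "(a, a \<otimes> s) \<in> edge_boundary (cayley_graph G S) A"
      using that A(1) by (auto simp: edge_boundary_def cayley_graph_def)
    thus False
      using empty by simp
  qed
  have closed: "\<forall>a\<in>A. a \<otimes> g \<in> A" if "g \<in> generate G S" for g
    using that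
  proof induction
    case one
    thus ?case using A(1) by auto
  next
    case (incl h)
    thus ?case using step by simp
  next
    case (inv h)
    thus ?case using step by simp
  next
    case (eng g h)
    have "g \<in> carrier G" "h \<in> carrier G"
      using eng.hyps assms(3) by auto
    thus ?case
      using eng.IH A(1) by (auto simp: m_assoc[symmetric])
  qed
  obtain a where a: "a \<in> A"
    using A(3) by blast
  have "carrier G \<subseteq> A"
  proof
    fix x assume x: "x \<in> carrier G"
    have "a \<otimes> (inv a \<otimes> x) \<in> A"
      using closed a x A(1) assms(3) by auto
    thus "x \<in> A"
      using a x A(1) by (auto simp: m_assoc[symmetric])
  qed
  thus False
    using assms(1) A(2) finite_subset by blast
qed

text \<open>The infimum is attained, and the attaining set has a nonempty finite boundary. Scale 0
  is excluded, where the infimum would be over the empty set.\<close>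

lemma isoperimetric_profile_cayley_graph_pos:
  assumes "infinite (carrier G)" "finite S" "S \<subseteq> carrier G" "generate G S = carrier G" "1 \<le> n"
  shows "isoperimetric_profile (cayley_graph G S) n > 0"
proof -
  let ?C = "cayley_graph G S"
  have verts: "verts ?C = carrier G"
    by (simp add: cayley_graph_def)
  have "verts ?C \<noteq> {}"
    using verts by auto
  then obtain A where A: "A \<subseteq> verts ?C" "finite A" "1 \<le> card A"
    "isoperimetric_profile ?C n = real (card (edge_boundary ?C A)) / real (card A)"
    using isoperimetric_profile_attained[of ?C n] assms(5) by metis
  have "edge_boundary ?C A \<noteq> {}"
    using A assms verts by (intro edge_boundary_cayley_graph_nonempty) auto
  hence "card (edge_boundary ?C A) > 0"
    using finite_edge_boundary_cayley_graph[OF assms(2,3) A(2)] by (simp add: card_gt_0_iff)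
  thus ?thesis
    using A(3,4) by simp
qed

end

section \<open>Drops of slowly decaying functions\<close>

text \<open>With only finitely many drops, the sequence in \<open>lim\<close> would eventually be
  nondecreasing, so it would stay above a positive value and could not tend to 0.\<close>

lemma infinite_halving_drops:
  fixes L w :: "nat \<Rightarrow> real"
  assumes pos: "\<And>n. 1 \<le> n \<Longrightarrow> L n > 0"
    and lim: "(\<lambda>k. L (2 ^ k) * exp (\<Sum>j=1..k. w (2 ^ j))) \<longlonglongrightarrow> 0"
  shows "infinite {N. w N * L N \<le> L (N div 2) - L N}"
proof
  assume "finite {N. w N * L N \<le> L (N div 2) - L N}"
  then obtain M where M: "\<And>N. w N * L N \<le> L (N div 2) - L N \<Longrightarrow> N \<le> M"
    unfolding finite_nat_set_iff_bounded_le by blast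
  define P where "P k = L (2 ^ k) * exp (\<Sum>j=1..k. w (2 ^ j))" for k :: nat
  have step: "P k \<le> P (Suc k)" if "M \<le> k" for k
  proof -
    \<comment> \<open>No drop occurs beyond \<open>M\<close>, so passing from \<open>2 ^ k\<close>
      to \<open>2 ^ Suc k\<close> loses less than a factor \<open>1 + w (2 ^ Suc k)\<close>, which
      the exponential weight absorbs.\<close>
    have "M < 2 ^ Suc k"
      using that less_exp[of "Suc k"] by linarith
    hence "L (2 ^ k) < (1 + w (2 ^ Suc k)) * L (2 ^ Suc k)"
      using M[of "2 ^ Suc k"] by (force simp: algebra_simps)
    also have "\<dots> \<le> exp (w (2 ^ Suc k)) * L (2 ^ Suc k)"
      using pos[of "2 ^ Suc k"] by (intro mult_right_mono exp_ge_add_one_self) auto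
    finally show ?thesis
      unfolding P_def by (simp add: exp_add mult_ac)
  qed
  have "P M \<le> P k" if "M \<le> k" for k
    using that by (induction k rule: dec_induct) (auto intro: order_trans step)
  moreover have "P \<longlonglongrightarrow> 0"
    using lim unfolding P_def .
  ultimately have "P M \<le> 0"
    by (intro LIMSEQ_le_const) auto
  thus False
    using pos[of "2 ^ M"] by (simp add: P_def mult_le_0_iff not_le)
qed

text \<open>Summable weights make the exponential factor converge, so decay of \<open>L\<close> to 0
  is enough.\<close>

lemma infinite_halving_drops_summable:
  fixes L w :: "nat \<Rightarrow> real"
  assumes "\<And>n. 1 \<le> n \<Longrightarrow> L n > 0" and "L \<longlonglongrightarrow> 0" and "summable (\<lambda>j. w (2 ^ j))"
  shows "infinite {N. w N * L N \<le> L (N div 2) - L N}"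
proof (rule infinite_halving_drops[OF assms(1)])
  \<comment> \<open>The series starts at \<open>j = 0\<close> while the halving sum starts at 1, so
    the term \<open>w 1\<close> is subtracted.\<close>
  have "(\<lambda>k. \<Sum>j<Suc k. w (2 ^ j)) \<longlonglongrightarrow> (\<Sum>j. w (2 ^ j))"
    using summable_LIMSEQ[OF assms(3)] by (rule LIMSEQ_Suc)
  hence "(\<lambda>k. (\<Sum>j<Suc k. w (2 ^ j)) - w 1) \<longlonglongrightarrow> (\<Sum>j. w (2 ^ j)) - w 1"
    by (intro tendsto_intros)
  moreover have "(\<Sum>j<Suc k. w (2 ^ j)) - w 1 = (\<Sum>j=1..k. w (2 ^ j))" for k
    by (simp add: sum.atLeast_Suc_atMost lessThan_Suc_atMost atMost_atLeast0)
  ultimately have "(\<lambda>k. \<Sum>j=1..k. w (2 ^ j)) \<longlonglongrightarrow> (\<Sum>j. w (2 ^ j)) - w 1"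
    by simp
  moreover have "filterlim (\<lambda>k::nat. 2 ^ k :: nat) sequentially sequentially"
    by (intro filterlim_subseq) (simp add: strict_mono_def)
  hence "(\<lambda>k. L (2 ^ k)) \<longlonglongrightarrow> 0"
    using assms(2) by (rule filterlim_compose[rotated])
  ultimately show "(\<lambda>k. L (2 ^ k) * exp (\<Sum>j=1..k. w (2 ^ j))) \<longlonglongrightarrow> 0"
    using tendsto_mult[OF _ tendsto_exp] by fastforce
qed auto

text \<open>The inequality \<open>ln x \<le> x - 1\<close> at \<open>x = k / (k + 1)\<close> bounds
  each new term by an increment of \<open>ln\<close>.\<close>

lemma sum_inverse_le_one_plus_ln:
  assumes "1 \<le> k"
  shows "(\<Sum>j=1..k. 1 / real j) \<le> 1 + ln (real k)"
  using assms
proof (induction k rule: dec_induct)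
  case (step k)
  have "ln (real k / real (Suc k)) \<le> real k / real (Suc k) - 1"
    using step by (intro ln_le_minus_one) auto
  also have "\<dots> = - (1 / real (Suc k))"
    by (simp add: field_simps)
  finally have "1 / real (Suc k) \<le> ln (real (Suc k)) - ln (real k)"
    using step by (simp add: ln_div)
  with step.IH show ?case
    by simp
qed simp

text \<open>Along powers of two the weight is \<open>a / 2\<close> times the harmonic series. It
  diverges, but its exponential grows at most like \<open>k powr (a / 2)\<close>, which the decay
  \<open>k powr (-a)\<close> of \<open>L\<close> beats.\<close>

lemma infinite_halving_drops_ln:
  fixes L :: "nat \<Rightarrow> real"
  assumes pos: "\<And>n. 1 \<le> n \<Longrightarrow> L n > 0" and "a > 0"
    and le: "L \<preceq> (\<lambda>N. 1 / ln (real N) powr a)"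
  shows "infinite {N. a * ln 2 / 2 / ln (real N) * L N \<le> L (N div 2) - L N}"
proof (rule infinite_halving_drops[OF pos])
  let ?f = "\<lambda>k. L (2 ^ k) * exp (\<Sum>j=1..k. a * ln 2 / 2 / ln (real (2 ^ j)))"
  obtain C where C: "C > 0" "\<forall>\<^sub>F N in sequentially. L N \<le> C * (1 / ln (real N) powr a)"
    using le by (auto simp: asymp_le_def)
  have "filterlim (\<lambda>k::nat. 2 ^ k :: nat) sequentially sequentially"
    by (intro filterlim_subseq) (simp add: strict_mono_def)
  hence "\<forall>\<^sub>F k in sequentially. L (2 ^ k) \<le> C * (1 / ln (real (2 ^ k)) powr a)"
    by (rule eventually_compose_filterlim[OF C(2)])
  moreover have "\<forall>\<^sub>F k::nat in sequentially. 1 \<le> k"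
    by (rule eventually_ge_at_top)
  ultimately have ub: "\<forall>\<^sub>F k in sequentially.
    ?f k \<le> C * (1 / (real k * ln 2) powr a) * exp (a / 2 * (1 + ln (real k)))"
  proof eventually_elim
    case (elim k)
    have "(\<Sum>j=1..k. a * ln 2 / 2 / ln (real (2 ^ j))) = a / 2 * (\<Sum>j=1..k. 1 / real j)"
      unfolding sum_distrib_left by (intro sum.cong) (auto simp: ln_realpow field_simps)
    also have "\<dots> \<le> a / 2 * (1 + ln (real k))"
      using sum_inverse_le_one_plus_ln[OF elim(2)] \<open>a > 0\<close> by (intro mult_left_mono) auto
    finally show ?case
      using elim(1) pos[of "2 ^ k"] C(1)
      by (intro mult_mono) (auto simp: ln_realpow)
  qed
  have "(\<lambda>k::nat. C * (1 / (real k * ln 2) powr a) * exp (a / 2 * (1 + ln (real k)))) \<longlonglongrightarrow> 0"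
    using \<open>a > 0\<close> C(1) by real_asymp
  moreover have "\<forall>\<^sub>F k in sequentially. 0 \<le> ?f k"
    using pos by (intro always_eventually) (auto intro!: mult_nonneg_nonneg less_imp_le)
  ultimately show "?f \<longlonglongrightarrow> 0"
    using real_tendsto_sandwich[OF _ ub tendsto_const] by blast
qed auto

section \<open>Consequences of asymptotic comparison, and iterated logarithms\<close>

lemma asymp_le_tendsto_0:
  assumes "u \<preceq> v" "\<And>n. 1 \<le> n \<Longrightarrow> 0 < u n" "v \<longlonglongrightarrow> 0"
  shows "u \<longlonglongrightarrow> 0"
proof -
  obtain C where C: "\<forall>\<^sub>F N in sequentially. u N \<le> C * v N"
    using assms(1) by (auto simp: asymp_le_def)
  have "(\<lambda>n. C * v n) \<longlonglongrightarrow> 0"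
    using assms(3) by (rule tendsto_mult_right_zero)
  moreover have "\<forall>\<^sub>F N in sequentially. 0 \<le> u N"
    using eventually_ge_at_top[of 1] by eventually_elim (use assms(2) in force)
  ultimately show ?thesis
    using real_tendsto_sandwich[OF _ C tendsto_const] by blast
qed

text \<open>Division by a nonnegative number preserves the pointwise inequalities; where
  \<open>w N = 0\<close>, both quotients are 0.\<close>

lemma asymp_eq_divide:
  assumes "u \<simeq> v" "\<forall>\<^sub>F N in sequentially. 0 \<le> w N"
  shows "(\<lambda>N. u N / w N) \<simeq> (\<lambda>N. v N / w N)"
proof -
  have "(\<lambda>N. f N / w N) \<preceq> (\<lambda>N. g N / w N)" if le: "f \<preceq> g" for f g
  proof -
    obtain C where C: "C > 0" "\<forall>\<^sub>F N in sequentially. f N \<le> C * g N"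
      using le by (auto simp: asymp_le_def)
    have "\<forall>\<^sub>F N in sequentially. f N / w N \<le> C * (g N / w N)"
      using C(2) assms(2)
      by eventually_elim (simp add: divide_right_mono)
    thus ?thesis
      using C(1) by (auto simp: asymp_le_def)
  qed
  thus ?thesis
    using assms(1) by (auto simp: asymp_eq_def)
qed

lemma filterlim_funpow_ln_at_top:
  "filterlim (\<lambda>N. (ln ^^ k) (real N)) at_top sequentially"
proof (induction k)
  case 0
  thus ?case by (simp add: filterlim_real_sequentially)
next
  case (Suc k)
  thus ?case using filterlim_compose[OF ln_at_top] by simp
qed

section \<open>Halving drops turned into separation bounds in the four decay regimes\<close>

theorem theorem1p6:
  fixes \<Gamma> :: "('g, 'm) monoid_scheme" and S :: "'g set" and a :: real
  defines "\<Lambda> \<equiv> isoperimetric_profile (cayley_graph \<Gamma> S)"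
    and "Sep \<equiv> separation_profile (cayley_graph \<Gamma> S)"
  assumes "group \<Gamma>" and "infinite (carrier \<Gamma>)"
    and "finite S" and "S \<subseteq> carrier \<Gamma>" and "generate \<Gamma> S = carrier \<Gamma>"
    and "a > 0"
  shows
    "(\<Lambda> \<simeq> (\<lambda>N. 1 / ln (real N) powr a) \<longrightarrow>
        (\<lambda>N. \<Lambda> N / ln (real N)) \<simeq> (\<lambda>N. 1 / ln (real N) powr (1 + a)) \<and>
        (\<exists>K>0. infinite {N. Sep N / real N \<ge> K * (\<Lambda> N / ln (real N))}))
     \<and>
     (\<Lambda> \<simeq> (\<lambda>N. 1 / ln (ln (real N)) powr a) \<longrightarrow>
        (\<exists>K>0. \<exists>C>0.
           (\<lambda>N. \<Lambda> N / ln (real N) powr C)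
              \<simeq> (\<lambda>N. 1 / (ln (ln (real N)) powr a * ln (real N) powr C)) \<and>
           infinite {N. Sep N / real N \<ge> K * (\<Lambda> N / ln (real N) powr C)}))
     \<and>
     (\<Lambda> \<preceq> (\<lambda>N. 1 / ln (real N) powr a) \<longrightarrow>
        (\<exists>K>0. infinite {N. Sep N / real N \<ge> K * (\<Lambda> N / ln (real N))}))
     \<and>
     (\<forall>k\<ge>2. \<Lambda> \<preceq> (\<lambda>N. 1 / ((ln ^^ k) (real N)) powr a) \<longrightarrow>
        (\<forall>\<epsilon>>0. \<exists>K>0. infinite {N. Sep N / real N \<ge> K * (\<Lambda> N / real N powr \<epsilon>)}))"
proof -
  interpret group \<Gamma> by fact
  interpret C: nomulti_digraph "cayley_graph \<Gamma> S"
    using assms by (intro nomulti_cayley_graph)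
  have pos: "\<Lambda> n > 0" if "1 \<le> n" for n
    unfolding \<Lambda>_def using assms that by (intro isoperimetric_profile_cayley_graph_pos)
  \<comment> \<open>Every drop at \<open>N \<ge> 2\<close> gives a separation bound with a quarter
    of the constant. Positivity of \<open>c\<close>, \<open>v\<close> and \<open>\<Lambda>\<close>
    makes the drop strict; the values 0 and 1 go into a finite exceptional set.\<close>
  have transfer: "infinite {N. Sep N / real N \<ge> c / 4 * (\<Lambda> N / v N)}"
    if "infinite {N. c / v N * \<Lambda> N \<le> \<Lambda> (N div 2) - \<Lambda> N}" "c > 0" "\<And>N. 2 \<le> N \<Longrightarrow> v N > 0"
    for c and v :: "nat \<Rightarrow> real"
  proof -
    have "{N. c / v N * \<Lambda> N \<le> \<Lambda> (N div 2) - \<Lambda> N}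
        \<subseteq> {..<2} \<union> {N. Sep N / real N \<ge> c / 4 * (\<Lambda> N / v N)}"
    proof clarsimp
      fix N :: nat
      assume N: "c * \<Lambda> N / v N \<le> \<Lambda> (N div 2) - \<Lambda> N" "\<not> N < 2"
      have "c * \<Lambda> N / v N > 0"
        using that(2,3) pos[of N] N(2) by simp
      hence "\<Lambda> N < \<Lambda> (N div 2)"
        using N(1) by linarith
      hence "(\<Lambda> (N div 2) - \<Lambda> N) / 4 \<le> Sep N / real N"
        unfolding \<Lambda>_def Sep_def using N(2) assms
        by (intro C.separation_profile_ge_isoperimetric_drop finite_edge_boundary_cayley_graph)
          (auto simp: cayley_graph_def)
      moreover have "(c * \<Lambda> N / v N) / 4 \<le> (\<Lambda> (N div 2) - \<Lambda> N) / 4"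
        using N(1) by (rule divide_right_mono) simp
      ultimately have "(c * \<Lambda> N / v N) / 4 \<le> Sep N / real N"
        by (rule order_trans[rotated])
      thus "c * \<Lambda> N / (4 * v N) \<le> Sep N / real N"
        by (simp add: mult.commute)
    qed
    thus ?thesis
      using that(1) finite_subset by blast
  qed
  have ln_nonneg: "\<forall>\<^sub>F N::nat in sequentially. 0 \<le> ln (real N)"
    using eventually_ge_at_top[of 1] by eventually_elim simp

  have part3: "\<exists>K>0. infinite {N. Sep N / real N \<ge> K * (\<Lambda> N / ln (real N))}"
    if "\<Lambda> \<preceq> (\<lambda>N. 1 / ln (real N) powr a)"
    using transfer[OF infinite_halving_drops_ln[OF pos \<open>a > 0\<close> that]] \<open>a > 0\<close>
    by (intro exI[of _ "a * ln 2 / 2 / 4"]) simp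

  have part1: "(\<lambda>N. \<Lambda> N / ln (real N)) \<simeq> (\<lambda>N. 1 / ln (real N) powr (1 + a))"
    if "\<Lambda> \<simeq> (\<lambda>N. 1 / ln (real N) powr a)"
  proof -
    have "1 / ln (real N) powr a / ln (real N) = 1 / ln (real N) powr (1 + a)" for N
      by (cases "N = 0") (auto simp: powr_add)
    thus ?thesis
      using asymp_eq_divide[OF that ln_nonneg] by simp
  qed

  \<comment> \<open>The exponent \<open>C = 2\<close> turns the weights along powers of two into a
    multiple of the summable series of inverse squares.\<close>
  have part2: "\<exists>K>0. \<exists>C>0.
           (\<lambda>N. \<Lambda> N / ln (real N) powr C)
              \<simeq> (\<lambda>N. 1 / (ln (ln (real N)) powr a * ln (real N) powr C)) \<and>
           infinite {N. Sep N / real N \<ge> K * (\<Lambda> N / ln (real N) powr C)}"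
    if eq: "\<Lambda> \<simeq> (\<lambda>N. 1 / ln (ln (real N)) powr a)"
  proof -
    have "(\<lambda>N::nat. 1 / ln (ln (real N)) powr a) \<longlonglongrightarrow> 0"
      using \<open>a > 0\<close> by real_asymp
    moreover have "\<Lambda> \<preceq> (\<lambda>N. 1 / ln (ln (real N)) powr a)"
      using eq by (simp add: asymp_eq_def)
    ultimately have "\<Lambda> \<longlonglongrightarrow> 0"
      using asymp_le_tendsto_0 pos by blast
    moreover have "summable (\<lambda>j. 1 / ln 2 ^ 2 * (1 / real j ^ 2))"
      using inverse_power_summable[of 2, where 'a = real]
      by (intro summable_mult) (simp add: field_simps)
    \<comment> \<open>At \<open>j = 0\<close> both forms of the term are 0, as division by 0 yields
      0.\<close>
    hence "summable (\<lambda>j. 1 / ln (real (2 ^ j)) powr 2)"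
      by (simp add: ln_realpow power_mult_distrib mult.commute)
    ultimately have "infinite {N. 1 / ln (real N) powr 2 * \<Lambda> N \<le> \<Lambda> (N div 2) - \<Lambda> N}"
      using pos by (intro infinite_halving_drops_summable)
    hence "infinite {N. Sep N / real N \<ge> 1 / 4 * (\<Lambda> N / ln (real N) powr 2)}"
      by (rule transfer) auto
    moreover have "(\<lambda>N. \<Lambda> N / ln (real N) powr 2)
              \<simeq> (\<lambda>N. 1 / (ln (ln (real N)) powr a * ln (real N) powr 2))"
      using asymp_eq_divide[OF eq, of "\<lambda>N. ln (real N) powr 2"] by simp
    ultimately show ?thesis
      by (intro exI[of _ "1 / 4"] exI[of _ 2] conjI) auto
  qed

  have part4: "\<exists>K>0. infinite {N. Sep N / real N \<ge> K * (\<Lambda> N / real N powr \<epsilon>)}"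
    if le: "\<Lambda> \<preceq> (\<lambda>N. 1 / ((ln ^^ k) (real N)) powr a)" and "\<epsilon> > 0" for k \<epsilon>
  proof -
    have "((\<lambda>x::real. 1 / x powr a) \<longlongrightarrow> 0) at_top"
      using \<open>a > 0\<close> by real_asymp
    hence "(\<lambda>N. 1 / ((ln ^^ k) (real N)) powr a) \<longlonglongrightarrow> 0"
      using filterlim_funpow_ln_at_top by (rule filterlim_compose)
    hence "\<Lambda> \<longlonglongrightarrow> 0"
      using asymp_le_tendsto_0 le pos by blast
    \<comment> \<open>Along powers of two the weight \<open>1 / real N powr \<epsilon>\<close> is a
      geometric series of ratio \<open>2 powr - \<epsilon>\<close>.\<close>
    have "summable (\<lambda>j. (2 powr - \<epsilon>) ^ j)"
      using \<open>\<epsilon> > 0\<close> by (intro summable_geometric) (simp add: powr_less_one)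
    moreover have "(2 powr - \<epsilon>) ^ j = 1 / real (2 ^ j) powr \<epsilon>" for j
      by (simp add: powr_minus_divide power_one_over powr_powr mult.commute flip: powr_realpow)
    ultimately have "summable (\<lambda>j. 1 / real (2 ^ j) powr \<epsilon>)"
      by simp
    with \<open>\<Lambda> \<longlonglongrightarrow> 0\<close> have "infinite {N. 1 / real N powr \<epsilon> * \<Lambda> N \<le> \<Lambda> (N div 2) - \<Lambda> N}"
      using pos by (intro infinite_halving_drops_summable)
    hence "infinite {N. Sep N / real N \<ge> 1 / 4 * (\<Lambda> N / real N powr \<epsilon>)}"
      by (rule transfer) auto
    thus ?thesis
      by (intro exI[of _ "1 / 4"]) simp
  qed

  \<comment> \<open>The separation bound in the first regime is that of the third, since
    \<open>\<simeq>\<close> contains \<open>\<preceq>\<close>.\<close>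
  show ?thesis
    using part1 part2 part3 part4 by (auto simp: asymp_eq_def)
qed

end
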